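(* For real $\theta>0$ let $S(w_0,z_0,z_1,z_2)$ be the stability function (defined in the context) of the second adaptation of the Modified Craig--Sneyd scheme with parameter $\theta$. Consider the condition $$|z_0|+|w_0|\le 2\sqrt{\operatorname{Re} z_1\,\operatorname{Re} z_2}\quad\text{and}\quad \operatorname{Re} z_1\le-\tfrac12|w_0|,\ \operatorname{Re} z_2\le-\tfrac12|w_0|. \qquad ( * )$$ (a) If $|S(w_0,z_0,z_1,z_2)|\le 1$ for all $w_0,z_0,z_1,z_2\in\mathbb{R}$ satisfying $( * )$ and $w_0\ge 0$, then $\theta\ge\frac12\sqrt2$. (b) There exists no $\theta>0$ such that $|S(w_0,z_0,z_1,z_2)|\le 1$ for all $w_0,z_0,z_1,z_2\in\mathbb{R}$ satisfying $( * )$.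
   Context: $\operatorname{Re}$ denotes the real part. For a real parameter $\theta>0$ and complex numbers $w_0,z_0,z_1,z_2$, put $$z=w_0+z_0+z_1+z_2,\qquad p=(1-\theta z_1)(1-\theta z_2),$$ $$S(w_0,z_0,z_1,z_2)=1+\left(1+\tfrac12 w_0\right)\left(\frac{z}{p}+\theta\,\frac{z_0 z}{p^2}+\left(\tfrac12-\theta\right)\frac{(z_0+z_1+z_2)z}{p^2}\right).$$ This is the function such that the second adaptation of the Modified Craig--Sneyd scheme with parameter $\theta$ (integral term treated in a one-step explicit trapezoidal fashion at the start of each step), applied to the scalar test equation $\dot U=(\lambda_0+\mu_0+\mu_1+\mu_2)U$ with step size $\Delta t$, gives $U_n=S(w_0,z_0,z_1,z_2)U_{n-1}$, where $w_0=\lambda_0\Delta t$ and $z_j=\mu_j\Delta t$ for $j=0,1,2$. *)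

theory Defs
  imports Complex_Main
begin

text \<open>Stability function of the second adaptation of the Modified Craig--Sneyd scheme with
  parameter \<open>\<theta>\<close>. The abbreviation \<open>p\<close> is nonzero whenever \<open>\<theta> > 0\<close>,
  \<open>Re z1 \<le> 0\<close> and \<open>Re z2 \<le> 0\<close>, so under condition \<open>mcs2_cond\<close> below
  no division by zero occurs.\<close>

definition mcs2_stab :: "real \<Rightarrow> complex \<Rightarrow> complex \<Rightarrow> complex \<Rightarrow> complex \<Rightarrow> complex" where
  "mcs2_stab \<theta> w0 z0 z1 z2 =
    (let z = w0 + z0 + z1 + z2;
         p = (1 - of_real \<theta> * z1) * (1 - of_real \<theta> * z2)
     in 1 + (1 + 1/2 * w0) *
          (z / p + of_real \<theta> * (z0 * z / p\<^sup>2)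
             + (1/2 - of_real \<theta>) * ((z0 + z1 + z2) * z / p\<^sup>2)))"

definition mcs2_cond :: "complex \<Rightarrow> complex \<Rightarrow> complex \<Rightarrow> complex \<Rightarrow> bool" where
  "mcs2_cond w0 z0 z1 z2 \<longleftrightarrow>
     cmod z0 + cmod w0 \<le> 2 * sqrt (Re z1 * Re z2) \<and>
     Re z1 \<le> - (1/2) * cmod w0 \<and> Re z2 \<le> - (1/2) * cmod w0"

end

theory Submission
  imports Defs "HOL-Computational_Algebra.Polynomial"
begin

text \<open>
  Both parts are decided on the diagonal \<open>z1 = z2 = -x\<close> with real \<open>x \<rightarrow> \<infinity>\<close>.
  For (a) take \<open>w0 = x\<close> and \<open>z0 = -x\<close>: then \<open>S\<close> tends to \<open>1 - 1/\<theta>\<^sup>2\<close>, which is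
  below \<open>-1\<close> when \<open>\<theta>\<^sup>2 < 1/2\<close>.  (Among \<open>w0 = c x\<close>, \<open>z0 = -(2 - c) x\<close> the limit is
  \<open>1 + c (c - 2)/\<theta>\<^sup>2\<close>, minimal at \<open>c = 1\<close>.)
  For (b) take \<open>w0 = -x\<close> and \<open>z0 = 0\<close>: both \<open>1 + w0/2\<close> and \<open>z\<close> are negative for \<open>x > 2\<close>,
  so that \<open>S > 1\<close> as soon as the remaining factor is positive.
\<close>

text \<open>With \<open>z1 = z2\<close> the denominator \<open>p\<close> is a square, so everything
  fits over \<open>(1 + \<theta> * x) ^ 4\<close>; the \<open>z0\<close> contributions with weights
  \<open>\<theta>\<close> and \<open>1/2 - \<theta>\<close> add up to \<open>z0 / 2\<close>.\<close>

lemma mcs2_stab_diagonal: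
  fixes \<theta> w0 z0 x :: real
  assumes "1 + \<theta> * x \<noteq> 0"
  shows "mcs2_stab \<theta> (of_real w0) (of_real z0) (of_real (- x)) (of_real (- x)) =
    of_real (1 + (1 + w0 / 2) * (w0 + z0 - 2 * x) *
      ((1 + \<theta> * x)\<^sup>2 + z0 / 2 - (1 - 2 * \<theta>) * x) / (1 + \<theta> * x) ^ 4)"
proof -
  define q where "q = 1 + \<theta> * x"
  have "q \<noteq> 0" using assms by (simp add: q_def)
  have "mcs2_stab \<theta> (of_real w0) (of_real z0) (of_real (- x)) (of_real (- x)) =
    of_real (1 + (1 + 1/2 * w0) * ((w0 + z0 - x - x) / (q * q)
      + \<theta> * (z0 * (w0 + z0 - x - x) / (q * q)\<^sup>2)
      + (1/2 - \<theta>) * ((z0 - x - x) * (w0 + z0 - x - x) / (q * q)\<^sup>2)))"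
    by (simp add: mcs2_stab_def Let_def q_def)
  also have "1 + (1 + 1/2 * w0) * ((w0 + z0 - x - x) / (q * q)
      + \<theta> * (z0 * (w0 + z0 - x - x) / (q * q)\<^sup>2)
      + (1/2 - \<theta>) * ((z0 - x - x) * (w0 + z0 - x - x) / (q * q)\<^sup>2))
    = 1 + (1 + w0 / 2) * (w0 + z0 - 2 * x) * (q\<^sup>2 + z0 / 2 - (1 - 2 * \<theta>) * x) / q ^ 4"
    using \<open>q \<noteq> 0\<close> by (simp add: field_simps power2_eq_square power4_eq_xxxx)
  finally show ?thesis by (simp add: q_def)
qed

text \<open>On the diagonal the square root is \<open>x\<close> itself, and the two remaining
  inequalities both read \<open>\<bar>w0\<bar> \<le> 2 * x\<close>, which follows from the
  first.\<close>

lemma mcs2_cond_diagonal: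
  fixes w0 z0 x :: real
  assumes "\<bar>z0\<bar> + \<bar>w0\<bar> \<le> 2 * x"
  shows "mcs2_cond (of_real w0) (of_real z0) (of_real (- x)) (of_real (- x))"
proof -
  have "x \<ge> 0" using assms by linarith
  then show ?thesis using assms by (simp add: mcs2_cond_def)
qed

text \<open>The expression is kept as the literal instance \<open>w0 = x\<close>,
  \<open>z0 = - x\<close> of the diagonal formula, so that it can be matched without
  rewriting.\<close>

lemma exists_mcs2_stab_lt_neg1:
  fixes \<theta> :: real
  assumes "\<theta> > 0" "\<theta> < 1/2 * sqrt 2"
  shows "\<exists>x>0. 1 + (1 + x / 2) * (x + (- x) - 2 * x) *
    ((1 + \<theta> * x)\<^sup>2 + (- x) / 2 - (1 - 2 * \<theta>) * x) / (1 + \<theta> * x) ^ 4 < - 1"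
proof -
  define a where "a = \<theta>\<^sup>2 - 2 * \<theta> ^ 4"
  \<comment> \<open>\<open>P\<close> is \<open>-1 - S\<close> multiplied by
    \<open>(1 + \<theta> * x) ^ 4\<close>, so \<open>S < -1\<close> amounts to \<open>P\<close>
    being positive at \<open>x\<close>. Its leading coefficient \<open>a\<close> factors as
    \<open>\<theta>\<^sup>2 * (1 - 2 * \<theta>\<^sup>2)\<close>, where the bound on
    \<open>\<theta>\<close> enters.\<close>
  define P where "P = [:- 2, 2 - 8 * \<theta>, 8 * \<theta> - 2 - 12 * \<theta>\<^sup>2,
    2 * \<theta>\<^sup>2 + 4 * \<theta> - 3/2 - 8 * \<theta> ^ 3, a:]"
  have "\<theta>\<^sup>2 < (1/2 * sqrt 2)\<^sup>2"
    using assms by (intro power_strict_mono) auto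
  then have "1 - 2 * \<theta>\<^sup>2 > 0" by (simp add: power_mult_distrib power_divide)
  then have "a > 0"
    using mult_pos_pos[of "\<theta>\<^sup>2" "1 - 2 * \<theta>\<^sup>2"] assms
    by (simp add: a_def algebra_simps flip: power_add)
  then have "lead_coeff P > 0" by (simp add: P_def)
  then obtain n where n: "\<And>x. x \<ge> n \<Longrightarrow> poly P x \<ge> lead_coeff P"
    using poly_pinfty_gt_lc by blast
  define x where "x = max n 1"
  define q where "q = 1 + \<theta> * x"
  have "x > 0" "poly P x > 0"
    using n[of x] \<open>lead_coeff P > 0\<close> by (auto simp: x_def)
  have "q > 0" using assms \<open>x > 0\<close> by (simp add: q_def add_pos_pos)
  have "poly P x = - ((1 + x / 2) * (x + (- x) - 2 * x) *
      (q\<^sup>2 + (- x) / 2 - (1 - 2 * \<theta>) * x)) - 2 * q ^ 4"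
    by (simp add: P_def a_def q_def power2_eq_square power3_eq_cube power4_eq_xxxx field_simps)
  then have "(1 + x / 2) * (x + (- x) - 2 * x) *
      (q\<^sup>2 + (- x) / 2 - (1 - 2 * \<theta>) * x) < - 2 * q ^ 4"
    using \<open>poly P x > 0\<close> by linarith
  then have "(1 + x / 2) * (x + (- x) - 2 * x) *
      (q\<^sup>2 + (- x) / 2 - (1 - 2 * \<theta>) * x) / q ^ 4 < - 2"
    using \<open>q > 0\<close> by (simp only: pos_divide_less_eq zero_less_power)
  then show ?thesis using \<open>x > 0\<close> unfolding q_def by (intro exI[of _ x]) linarith
qed

text \<open>Again a literal instance of the diagonal formula, now with \<open>w0 = - x\<close> and
  \<open>z0 = 0\<close>.\<close>

lemma exists_mcs2_stab_gt_1:
  fixes \<theta> :: real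
  assumes "\<theta> > 0"
  shows "\<exists>x>0. 1 + (1 + (- x) / 2) * (- x + 0 - 2 * x) *
    ((1 + \<theta> * x)\<^sup>2 + 0 / 2 - (1 - 2 * \<theta>) * x) / (1 + \<theta> * x) ^ 4 > 1"
proof -
  \<comment> \<open>The summand 3 makes \<open>1 - x / 2\<close> negative; the summand
    \<open>1 / \<theta>\<^sup>2\<close> gives \<open>\<theta>\<^sup>2 * x\<^sup>2 \<ge> x\<close>,
    which absorbs the only negative term of
    \<open>1 + 4 * \<theta> * x + \<theta>\<^sup>2 * x\<^sup>2 - x\<close>.\<close>
  define x where "x = 3 + 1 / \<theta>\<^sup>2"
  have "x > 3" using assms by (simp add: x_def)
  have "\<theta>\<^sup>2 * x \<ge> 1" using assms by (simp add: x_def field_simps)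
  then have "\<theta>\<^sup>2 * x * x \<ge> 1 * x"
    using \<open>x > 3\<close> by (intro mult_right_mono) auto
  moreover have "\<theta> * x > 0" using assms \<open>x > 3\<close> by simp
  ultimately have "(1 + \<theta> * x)\<^sup>2 + 0 / 2 - (1 - 2 * \<theta>) * x > 0"
    by (simp add: power2_eq_square algebra_simps)
  moreover have "(1 + (- x) / 2) * (- x + 0 - 2 * x) > 0"
    using \<open>x > 3\<close> by (intro mult_neg_neg) auto
  moreover have "(1 + \<theta> * x) ^ 4 > 0" using \<open>\<theta> * x > 0\<close> by simp
  ultimately have "(1 + (- x) / 2) * (- x + 0 - 2 * x) *
    ((1 + \<theta> * x)\<^sup>2 + 0 / 2 - (1 - 2 * \<theta>) * x) / (1 + \<theta> * x) ^ 4 > 0"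
    by (metis divide_pos_pos mult_pos_pos)
  then show ?thesis using \<open>x > 3\<close> by (intro exI[of _ x]) linarith
qed

theorem theorem3:
  shows "(\<forall>\<theta>::real. \<theta> > 0 \<longrightarrow>
            (\<forall>w0 z0 z1 z2 :: real.
               mcs2_cond (complex_of_real w0) (complex_of_real z0) (complex_of_real z1) (complex_of_real z2)
               \<and> w0 \<ge> 0 \<longrightarrow>
               cmod (mcs2_stab \<theta> (complex_of_real w0) (complex_of_real z0)
                                  (complex_of_real z1) (complex_of_real z2)) \<le> 1) \<longrightarrow>
            \<theta> \<ge> 1/2 * sqrt 2)
       \<and> (\<nexists>\<theta>::real. \<theta> > 0 \<and>
            (\<forall>w0 z0 z1 z2 :: real.
               mcs2_cond (complex_of_real w0) (complex_of_real z0) (complex_of_real z1) (complex_of_real z2) \<longrightarrow>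
               cmod (mcs2_stab \<theta> (complex_of_real w0) (complex_of_real z0)
                                  (complex_of_real z1) (complex_of_real z2)) \<le> 1))"
proof (intro conjI allI impI notI)
  fix \<theta> :: real
  assume "\<theta> > 0" and stable: "\<forall>w0 z0 z1 z2 :: real.
    mcs2_cond (of_real w0) (of_real z0) (of_real z1) (of_real z2) \<and> w0 \<ge> 0 \<longrightarrow>
    cmod (mcs2_stab \<theta> (of_real w0) (of_real z0) (of_real z1) (of_real z2)) \<le> 1"
  show "\<theta> \<ge> 1/2 * sqrt 2"
  proof (rule ccontr)
    assume "\<not> \<theta> \<ge> 1/2 * sqrt 2"
    then obtain x where "x > 0" and lt: "1 + (1 + x / 2) * (x + (- x) - 2 * x) *
      ((1 + \<theta> * x)\<^sup>2 + (- x) / 2 - (1 - 2 * \<theta>) * x) / (1 + \<theta> * x) ^ 4 < - 1"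
      using exists_mcs2_stab_lt_neg1[of \<theta>] \<open>\<theta> > 0\<close> by auto
    have nz: "1 + \<theta> * x \<noteq> 0"
      using mult_pos_pos[OF \<open>\<theta> > 0\<close> \<open>x > 0\<close>] by linarith
    \<comment> \<open>This point lies on the boundary of the condition:
      \<open>\<bar>z0\<bar> + \<bar>w0\<bar>\<close> equals \<open>2 * x\<close>.\<close>
    have "cmod (mcs2_stab \<theta> (of_real x) (of_real (- x)) (of_real (- x)) (of_real (- x))) \<le> 1"
      using stable[rule_format, of x "- x" "- x" "- x"] mcs2_cond_diagonal[of "- x" x x] \<open>x > 0\<close> by simp
    then show False
      unfolding mcs2_stab_diagonal[OF nz] norm_of_real using lt by linarith
  qed
next
  assume "\<exists>\<theta>::real. \<theta> > 0 \<and> (\<forall>w0 z0 z1 z2 :: real.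
    mcs2_cond (of_real w0) (of_real z0) (of_real z1) (of_real z2) \<longrightarrow>
    cmod (mcs2_stab \<theta> (of_real w0) (of_real z0) (of_real z1) (of_real z2)) \<le> 1)"
  then obtain \<theta> :: real where "\<theta> > 0" and stable: "\<And>w0 z0 z1 z2 :: real.
    mcs2_cond (of_real w0) (of_real z0) (of_real z1) (of_real z2) \<Longrightarrow>
    cmod (mcs2_stab \<theta> (of_real w0) (of_real z0) (of_real z1) (of_real z2)) \<le> 1"
    by blast
  obtain x where "x > 0" and gt: "1 + (1 + (- x) / 2) * (- x + 0 - 2 * x) *
    ((1 + \<theta> * x)\<^sup>2 + 0 / 2 - (1 - 2 * \<theta>) * x) / (1 + \<theta> * x) ^ 4 > 1"
    using exists_mcs2_stab_gt_1[OF \<open>\<theta> > 0\<close>] by blast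
  have nz: "1 + \<theta> * x \<noteq> 0"
    using mult_pos_pos[OF \<open>\<theta> > 0\<close> \<open>x > 0\<close>] by linarith
  \<comment> \<open>The negative \<open>w0\<close> is admissible here because (b) imposes no sign on
    it.\<close>
  have "cmod (mcs2_stab \<theta> (of_real (- x)) (of_real 0) (of_real (- x)) (of_real (- x))) \<le> 1"
    using \<open>x > 0\<close> by (intro stable mcs2_cond_diagonal) simp
  then show False
    unfolding mcs2_stab_diagonal[OF nz] norm_of_real using gt by linarith
qed

end
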